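(* Let $d \ge 1$ and let $n_1, \ldots, n_d$ be positive integers, one or more of which are odd. Consider the toroidal, uniform $d$-dimensional lattice of size $N = \prod_{i=1}^d n_i$, with points $x = (x_1, \ldots, x_d)$, $0 \le x_i \le n_i - 1$. For each $i$ define $$\delta(x_i) = \begin{cases} 1, & \text{if } x_i = n_i - 1 \text{ and } (n_i - 1) \bmod 3 = 0,\\ 0, & \text{otherwise.}\end{cases}$$ Then the lattice admits a three-coloring in which the point $x = (x_1, \ldots, x_d)$ receives the color $$C(x) = \left( \sum_{i=1}^d x_i + \sum_{i=1}^d \delta(x_i) \right) \bmod 3 .$$ That is, $C(x) \ne C(x')$ for any two neighboring points $x, x'$ of the lattice.
   Context: The toroidal (periodic) uniform lattice of size $\prod_{i=1}^d n_i$ is the graph whose vertices are the integer points $x = (x_1,\ldots,x_d)$ with $0 \le x_i \le n_i-1$. Two distinct points are neighbors if they agree in all coordinates except one coordinate $j$, and in that coordinate $x_j - x'_j \equiv \pm 1 \pmod{n_j}$ (so $0$ and $n_j - 1$ are neighbors in dimension $j$ by wrap-around). A three-coloring is an assignment of one of three colors (here $0,1,2$) to each vertex such that neighboring vertices receive different colors. *)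

theory Defs
  imports "HOL-Library.FuncSet" "HOL-Number_Theory.Cong"
begin

text \<open>
  A point is a function on the coordinate indices \<open>1..d\<close>. The dependent product
  \<open>PiE\<close> pins its values outside \<open>{1..d}\<close>, so that function equality is
  equality of points.
\<close>

definition torus_points :: "nat \<Rightarrow> (nat \<Rightarrow> nat) \<Rightarrow> (nat \<Rightarrow> nat) set" where
  "torus_points d n = (\<Pi>\<^sub>E i\<in>{1..d}. {0..<n i})"

lemma card_torus_points: "card (torus_points d n) = (\<Prod>i=1..d. n i)"
  by (simp add: torus_points_def card_PiE)

text \<open>
  Distinctness is required separately: for \<open>n j = 1\<close> the congruence holds already
  between a point and itself.
\<close>

definition torus_neighbors ::
  "nat \<Rightarrow> (nat \<Rightarrow> nat) \<Rightarrow> (nat \<Rightarrow> nat) \<Rightarrow> (nat \<Rightarrow> nat) \<Rightarrow> bool" where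
  "torus_neighbors d n x x' \<longleftrightarrow>
     x \<in> torus_points d n \<and> x' \<in> torus_points d n \<and> x \<noteq> x' \<and>
     (\<exists>j\<in>{1..d}. (\<forall>i\<in>{1..d} - {j}. x i = x' i) \<and>
        ([int (x j) - int (x' j) = 1] (mod int (n j)) \<or>
         [int (x j) - int (x' j) = -1] (mod int (n j))))"

definition torus_three_coloring ::
  "nat \<Rightarrow> (nat \<Rightarrow> nat) \<Rightarrow> ((nat \<Rightarrow> nat) \<Rightarrow> nat) \<Rightarrow> bool" where
  "torus_three_coloring d n c \<longleftrightarrow>
     (\<forall>x\<in>torus_points d n. c x \<in> {0, 1, 2}) \<and>
     (\<forall>x x'. torus_neighbors d n x x' \<longrightarrow> c x \<noteq> c x')"

text \<open>\<open>wrap_shift m k\<close> is $\delta(k)$ for a coordinate \<open>k\<close> that ranges over \<open>0..m - 1\<close>.\<close>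

definition wrap_shift :: "nat \<Rightarrow> nat \<Rightarrow> nat" where
  "wrap_shift m k = (if k = m - 1 \<and> (m - 1) mod 3 = 0 then 1 else 0)"

definition torus_color :: "nat \<Rightarrow> (nat \<Rightarrow> nat) \<Rightarrow> (nat \<Rightarrow> nat) \<Rightarrow> nat" where
  "torus_color d n x = ((\<Sum>i=1..d. x i) + (\<Sum>i=1..d. wrap_shift (n i) (x i))) mod 3"

end

theory Submission
  imports Defs
begin

text \<open>
  Neighbors differ in a single coordinate, so it suffices that
  \<open>k + wrap_shift m k\<close> modulo 3 properly colors the cycle of length \<open>m\<close>.
  Unshifted, the residues fail only at the wrap-around edge between \<open>0\<close> and \<open>m - 1\<close>, and only when
  3 divides \<open>m - 1\<close>. In that case the shift gives \<open>m - 1\<close> the color 1,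
  while \<open>m - 2\<close> has color 2 and \<open>0\<close> has color 0.
\<close>

text \<open>Since \<open>a\<close> and \<open>b\<close> lie below \<open>m\<close>, the integer
  \<open>a - b - 1\<close> lies between \<open>-m\<close> and \<open>m - 2\<close>. As a multiple of
  \<open>m\<close> it is therefore \<open>0\<close> (an ordinary step) or \<open>-m\<close> (the
  wrap-around).\<close>

lemma cyclic_succ_cases:
  fixes a b m :: nat
  assumes "a < m" "b < m" "[int a - int b = 1] (mod int m)"
  shows "a = Suc b \<or> a = 0 \<and> b = m - 1"
proof -
  obtain q where q: "int a - int b - 1 = int m * q"
    using assms(3) by (auto simp: cong_iff_dvd_diff)
  have "int m * q < int m * 1" "int m * (-2) < int m * q"
    using assms(1,2) q by linarith+
  then have "q < 1" "-2 < q"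
    by (metis mult_less_cancel_left_pos assms(1) of_nat_0_less_iff gr_zeroI not_less_zero)+
  then have "q = 0 \<or> q = -1"
    by linarith
  then show ?thesis
    using assms(1,2) q by auto
qed

lemma wrap_shift_succ_neq:
  fixes a b m :: nat
  assumes "a < m" "b < m" "a \<noteq> b" "[int a - int b = 1] (mod int m)"
  shows "\<not> [a + wrap_shift m a = b + wrap_shift m b] (mod 3)"
  using cyclic_succ_cases[OF assms(1,2,4)]
proof
  assume a: "a = Suc b"
  then have "wrap_shift m b = 0"
    using assms(1) by (simp add: wrap_shift_def)
  moreover have "wrap_shift m a = 0 \<or> wrap_shift m a = 1"
    by (simp add: wrap_shift_def)
  \<comment> \<open>The shifted value grows by 1, or by 2 if \<open>a\<close> is the shifted end
    point; neither is 0 modulo 3.\<close>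
  moreover have "Suc b mod 3 \<noteq> b mod 3" "Suc (Suc b) mod 3 \<noteq> b mod 3"
    by presburger+
  ultimately show ?thesis
    using a by (auto simp: cong_def)
next
  assume ab: "a = 0 \<and> b = m - 1"
  \<comment> \<open>\<open>a \<noteq> b\<close> excludes \<open>m = 1\<close>, where
    \<open>0\<close> would itself be the last point and carry the shift.\<close>
  then have "wrap_shift m a = 0" "wrap_shift m b = (if b mod 3 = 0 then 1 else 0)"
    using assms(3) by (auto simp: wrap_shift_def)
  moreover have "b mod 3 = 0 \<Longrightarrow> Suc b mod 3 \<noteq> 0"
    by presburger
  ultimately show ?thesis
    using ab by (auto simp: cong_def)
qed

lemma wrap_shift_neighbor_neq:
  fixes a b m :: nat
  assumes "a < m" "b < m" "a \<noteq> b"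
    and "[int a - int b = 1] (mod int m) \<or> [int a - int b = -1] (mod int m)"
  shows "\<not> [a + wrap_shift m a = b + wrap_shift m b] (mod 3)"
  using assms(4)
proof
  assume "[int a - int b = 1] (mod int m)"
  then show ?thesis
    using assms(1-3) by (rule wrap_shift_succ_neq[rotated 3])
next
  assume "[int a - int b = -1] (mod int m)"
  then have "[int b - int a = 1] (mod int m)"
    using cong_minus_minus_iff[of "int b - int a" 1 "int m"] by simp
  then show ?thesis
    using wrap_shift_succ_neq[of b m a] assms(1-3) by (simp add: cong_sym_eq)
qed

text \<open>All coordinates except \<open>j\<close> contribute the same amount \<open>r\<close> to
  both colors. Cancelling \<open>r\<close> modulo 3 leaves the one-dimensional claim for the cycle
  of length \<open>n j\<close>.\<close>

lemma torus_color_neighbors_neq: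
  assumes "torus_neighbors d n x x'"
  shows "torus_color d n x \<noteq> torus_color d n x'"
proof -
  have x: "x \<in> torus_points d n" and x': "x' \<in> torus_points d n" and ne: "x \<noteq> x'"
    using assms by (auto simp: torus_neighbors_def)
  obtain j where j: "j \<in> {1..d}"
    and eq: "\<And>i. i \<in> {1..d} - {j} \<Longrightarrow> x i = x' i"
    and adj: "[int (x j) - int (x' j) = 1] (mod int (n j)) \<or>
              [int (x j) - int (x' j) = -1] (mod int (n j))"
    using assms unfolding torus_neighbors_def by blast
  \<comment> \<open>The congruence alone does not give this when \<open>n j = 1\<close>; it follows
    from \<open>x \<noteq> x'\<close>, as the points agree in all other coordinates.\<close>
  have "x j \<noteq> x' j"
  proof
    assume "x j = x' j"
    then have "x i = x' i" if "i \<in> {1..d}" for i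
      using eq that by (cases "i = j") auto
    then have "x = x'"
      using x x' unfolding torus_points_def by (rule PiE_ext[rotated 2])
    with ne show False ..
  qed
  moreover have "x j < n j" "x' j < n j"
    using x x' j by (auto simp: torus_points_def dest: PiE_mem)
  ultimately have neq: "\<not> [x j + wrap_shift (n j) (x j) = x' j + wrap_shift (n j) (x' j)] (mod 3)"
    using adj by (intro wrap_shift_neighbor_neq) auto
  define r where "r = (\<Sum>i\<in>{1..d} - {j}. x i + wrap_shift (n i) (x i))"
  have "r = (\<Sum>i\<in>{1..d} - {j}. x' i + wrap_shift (n i) (x' i))"
    unfolding r_def using eq by (intro sum.cong) simp_all
  moreover have "torus_color d n y =
      (y j + wrap_shift (n j) (y j) + (\<Sum>i\<in>{1..d} - {j}. y i + wrap_shift (n i) (y i))) mod 3" for y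
    unfolding torus_color_def sum.distrib[symmetric] by (subst sum.remove[OF _ j]) simp_all
  ultimately have "torus_color d n x = (x j + wrap_shift (n j) (x j) + r) mod 3"
    "torus_color d n x' = (x' j + wrap_shift (n j) (x' j) + r) mod 3"
    by (simp_all only: r_def)
  then show ?thesis
    using neq by (metis cong_add_rcancel_nat cong_def)
qed

theorem theorem3p5:
  fixes d :: nat and n :: "nat \<Rightarrow> nat"
  assumes "d \<ge> 1"
    and "\<forall>i\<in>{1..d}. n i > 0"
    and "\<exists>i\<in>{1..d}. odd (n i)"
  shows "torus_three_coloring d n (torus_color d n)"
  unfolding torus_three_coloring_def
proof (intro conjI ballI allI impI)
  show "torus_color d n x \<in> {0, 1, 2}" for x
    unfolding torus_color_def by auto
  show "torus_color d n x \<noteq> torus_color d n x'" if "torus_neighbors d n x x'" for x x'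
    using that by (rule torus_color_neighbors_neq)
qed

end
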